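(* Let $A$ be a uniform algebra, viewed as a uniformly closed subalgebra of $C(X,\mathbb{C})$, where $X=M(A)$ is the maximal ideal space (spectrum) of $A$. Suppose that $n:=\operatorname{snr}A<\infty$ and let $(\boldsymbol f,g)\in U_{n+1}(A)$. If the zero set $Z(g)=\{x\in X: g(x)=0\}$ meets the Shilov boundary of $A$, then $(\boldsymbol f,g)$ is norm-one reducible, that is, there exists $\boldsymbol c=(c_1,\dots,c_n)\in A^n$ such that $\|c_j\|_\infty=1$ for $j=1,\dots,n$ and $\boldsymbol f+\boldsymbol c\,g\in U_n(A)$.
   Context: A uniform algebra is a uniformly closed subalgebra (with the supremum norm $\|\cdot\|_\infty$) of the algebra of continuous complex-valued functions on a compact Hausdorff space that contains the constants and separates points; it is identified via the Gelfand transform with a uniformly closed subalgebra of $C(M(A),\mathbb{C})$, and its Shilov boundary is regarded as a subset of $M(A)$. For a commutative unital algebra $A$ and an integer $n\ge 1$, let $U_n(A)=\{(f_1,\dots,f_n)\in A^n:\ \sum_{j=1}^n Af_j=A\}$ be the set of invertible $n$-tuples. For $\boldsymbol f,\boldsymbol x\in A^n$ and $g\in A$, $\boldsymbol f+\boldsymbol x\,g$ means $(f_1+x_1g,\dots,f_n+x_ng)$. The small-norm rank $\operatorname{snr}A$ of a commutative unital normed algebra $A=(A,\|\cdot\|)$ is the smallest integer $n\ge 1$ (or $\infty$ if there is none) such that for every $\varepsilon>0$ and every $(\boldsymbol f,g)\in U_{n+1}(A)$ there is $\boldsymbol a=(a_1,\dots,a_n)\in A^n$ with $\|a_j\|<\varepsilon$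 for all $j$ and $\boldsymbol f+\boldsymbol a\,g\in U_n(A)$. *)

theory Defs
  imports "HOL-Analysis.Analysis" "HOL-Library.Function_Algebras" "HOL-Library.Extended_Nat"
begin

text \<open>
  An \<open>n\<close>-tuple is a function on \<open>nat\<close> of which only the entries at \<open>1, \<dots>, n\<close> matter;
  accordingly the \<open>(n+1)\<close>-tuple \<open>(f, g)\<close> is \<open>f(Suc n := g)\<close>. The algebra \<open>A\<close> is a unital
  subalgebra of an ambient commutative ring, and the norm is passed as an argument.
\<close>

definition invertible_tuples :: "'r::comm_ring_1 set \<Rightarrow> nat \<Rightarrow> (nat \<Rightarrow> 'r) set" where
  "invertible_tuples A n =
     {f. (\<forall>j\<in>{1..n}. f j \<in> A) \<and>
         {\<Sum>j=1..n. h j * f j |h. \<forall>j\<in>{1..n}. h j \<in> A} = A}"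

definition small_norm_reducible :: "('r::comm_ring_1 \<Rightarrow> real) \<Rightarrow> 'r set \<Rightarrow> nat \<Rightarrow> bool" where
  "small_norm_reducible nrm A n \<longleftrightarrow>
     (\<forall>\<epsilon>>0. \<forall>f g. f(Suc n := g) \<in> invertible_tuples A (Suc n) \<longrightarrow>
        (\<exists>a. (\<forall>j\<in>{1..n}. a j \<in> A \<and> nrm (a j) < \<epsilon>) \<and>
             (\<lambda>j. f j + a j * g) \<in> invertible_tuples A n))"

text \<open>The infimum of the empty set in \<^typ>\<open>enat\<close> is \<open>\<infinity>\<close>.\<close>

definition snr :: "('r::comm_ring_1 \<Rightarrow> real) \<Rightarrow> 'r set \<Rightarrow> enat" where
  "snr nrm A = Inf {enat n |n. 1 \<le> n \<and> small_norm_reducible nrm A n}"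

definition sup_norm :: "('a \<Rightarrow> complex) \<Rightarrow> real" where
  "sup_norm f = (SUP x. cmod (f x))"

text \<open>
  The underlying compact Hausdorff space is the whole type \<open>'a\<close>; it need not be the spectrum
  of \<open>A\<close>. Sums and products of functions are pointwise. Closure under scalar multiples
  follows from that under products, since \<open>A\<close> contains the constants.
\<close>

locale uniform_algebra =
  fixes A :: "('a::t2_space \<Rightarrow> complex) set"
  assumes compact_UNIV: "compact (UNIV :: 'a set)"
    and continuous: "f \<in> A \<Longrightarrow> continuous_on UNIV f"
    and const_mem: "(\<lambda>_. c) \<in> A"
    and add_mem: "f \<in> A \<Longrightarrow> g \<in> A \<Longrightarrow> f + g \<in> A"
    and mult_mem: "f \<in> A \<Longrightarrow> g \<in> A \<Longrightarrow> f * g \<in> A"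
    and separates_points: "x \<noteq> y \<Longrightarrow> \<exists>f\<in>A. f x \<noteq> f y"
    and uniformly_closed:
      "(\<And>k. F k \<in> A) \<Longrightarrow> uniform_limit UNIV F f sequentially \<Longrightarrow> f \<in> A"

text \<open>
  The spectrum \<open>M(A)\<close>: the nonzero multiplicative linear functionals on \<open>A\<close>, made
  extensional so that each is represented by exactly one function, with the topology of
  pointwise convergence on \<open>A\<close>.
\<close>

definition spectrum :: "('a \<Rightarrow> complex) set \<Rightarrow> (('a \<Rightarrow> complex) \<Rightarrow> complex) set" where
  "spectrum A =
     {\<phi> \<in> extensional A.
        (\<forall>f\<in>A. \<forall>g\<in>A. \<phi> (f + g) = \<phi> f + \<phi> g) \<and>
        (\<forall>c. \<forall>f\<in>A. \<phi> ((\<lambda>_. c) * f) = c * \<phi> f) \<and>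
        (\<forall>f\<in>A. \<forall>g\<in>A. \<phi> (f * g) = \<phi> f * \<phi> g) \<and>
        (\<exists>f\<in>A. \<phi> f \<noteq> 0)}"

definition gelfand_topology :: "('a \<Rightarrow> complex) set \<Rightarrow> (('a \<Rightarrow> complex) \<Rightarrow> complex) topology" where
  "gelfand_topology A = subtopology (product_topology (\<lambda>_. euclidean) A) (spectrum A)"

definition gelfand :: "('a \<Rightarrow> complex) \<Rightarrow> (('a \<Rightarrow> complex) \<Rightarrow> complex) \<Rightarrow> complex" where
  "gelfand f \<phi> = \<phi> f"

definition zero_set :: "('a \<Rightarrow> complex) set \<Rightarrow> ('a \<Rightarrow> complex) \<Rightarrow> (('a \<Rightarrow> complex) \<Rightarrow> complex) set" where
  "zero_set A g = {\<phi> \<in> spectrum A. gelfand g \<phi> = 0}"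

definition closed_boundary :: "('a \<Rightarrow> complex) set \<Rightarrow> (('a \<Rightarrow> complex) \<Rightarrow> complex) set \<Rightarrow> bool" where
  "closed_boundary A E \<longleftrightarrow>
     closedin (gelfand_topology A) E \<and>
     (\<forall>f\<in>A. \<exists>\<phi>\<in>E. \<forall>\<psi>\<in>spectrum A. cmod (gelfand f \<psi>) \<le> cmod (gelfand f \<phi>))"

text \<open>
  By Shilov's theorem the intersection of all closed boundaries is itself one, hence the
  smallest one.
\<close>

definition shilov_boundary :: "('a \<Rightarrow> complex) set \<Rightarrow> (('a \<Rightarrow> complex) \<Rightarrow> complex) set" where
  "shilov_boundary A = \<Inter> {E. closed_boundary A E}"

end

theory Submission imports Defs begin

text \<open>
  By smallness of the norm rank there is a tuple \<open>a\<close> with entries of norm less than one such that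
  \<open>f + a g\<close> is invertible. Since \<open>g\<close> vanishes at a point of the Shilov boundary, it is a
  topological divisor of zero: there is \<open>h\<close> with \<open>h g\<close> arbitrarily small compared with \<open>h\<close>
  (otherwise, testing on powers of an arbitrary function, \<open>{|g| \<ge> \<eta>}\<close> would be a closed boundary).
  Invertible tuples form an open set, so each \<open>a j\<close> may be replaced by \<open>a j + t h\<close>, with \<open>t\<close>
  chosen by the intermediate value theorem so that the norm becomes one.
\<close>

context uniform_algebra
begin

section \<open>Closure properties of \<open>A\<close>, the supremum norm and Neumann series\<close>

lemma uminus_mem: "f \<in> A \<Longrightarrow> - f \<in> A"
  using mult_mem[OF const_mem[of "- 1"], of f] by (simp add: fun_eq_iff times_fun_def fun_Compl_def)

lemma scale_mem: "f \<in> A \<Longrightarrow> (\<lambda>x. c * f x) \<in> A"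
  using mult_mem[OF const_mem[of c], of f] by (simp add: times_fun_def)

lemma power_mem: "f \<in> A \<Longrightarrow> (\<lambda>x. f x ^ k) \<in> A"
proof (induction k)
  case 0
  show ?case using const_mem[of 1] by simp
next
  case (Suc k)
  then show ?case using mult_mem[of f "\<lambda>x. f x ^ k"] by (simp add: times_fun_def)
qed

lemma sum_mem: "(\<And>i. i \<in> I \<Longrightarrow> f i \<in> A) \<Longrightarrow> (\<Sum>i\<in>I. f i) \<in> A"
proof (induction I rule: infinite_finite_induct)
  case (insert i I)
  then have "f i + sum f I \<in> A" by (intro add_mem) auto
  with insert(1,2) show ?case by (subst sum.insert)
\<comment> \<open>The remaining cases are the infinite and the empty index set; in both the sum is
  by convention the constant 0.\<close>
qed (use const_mem[of 0] in \<open>simp_all add: zero_fun_def\<close>)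

lemma sum_fun_apply: "(\<Sum>i\<in>I. f i) x = (\<Sum>i\<in>I. f i x :: complex)"
  by (induction I rule: infinite_finite_induct) auto

lemma bdd_above_cmod: "f \<in> A \<Longrightarrow> bdd_above (range (\<lambda>x. cmod (f x)))"
  by (intro bounded_imp_bdd_above compact_imp_bounded compact_continuous_image
      continuous_intros continuous compact_UNIV)

lemma cmod_le_sup_norm: "f \<in> A \<Longrightarrow> cmod (f x) \<le> sup_norm f"
  unfolding sup_norm_def by (intro cSUP_upper bdd_above_cmod) auto

lemma sup_norm_le: "(\<And>x. cmod (f x) \<le> c) \<Longrightarrow> sup_norm f \<le> c" for f :: "'a \<Rightarrow> complex"
  unfolding sup_norm_def by (intro cSUP_least) auto

lemma sup_norm_nonneg: "f \<in> A \<Longrightarrow> 0 \<le> sup_norm f"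
  using cmod_le_sup_norm[of f] norm_ge_zero order_trans by blast

lemma sup_norm_add_le:
  assumes "f \<in> A" "g \<in> A" shows "sup_norm (f + g) \<le> sup_norm f + sup_norm g"
proof (rule sup_norm_le)
  fix x show "cmod ((f + g) x) \<le> sup_norm f + sup_norm g"
    using norm_triangle_ineq[of "f x" "g x"] cmod_le_sup_norm[OF assms(1), of x]
      cmod_le_sup_norm[OF assms(2), of x] by simp
qed

lemma sup_norm_scale_le: "f \<in> A \<Longrightarrow> sup_norm (\<lambda>x. c * f x) \<le> cmod c * sup_norm f"
  by (intro sup_norm_le) (auto simp: norm_mult intro!: mult_left_mono cmod_le_sup_norm)

text \<open>Neumann series: the M-test with majorant \<open>sup_norm u ^ i\<close> makes the
  geometric series in \<open>u\<close> converge uniformly, and uniform closedness of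
  \<open>A\<close> keeps its sum in \<open>A\<close>.\<close>

lemma one_minus_invertible:
  assumes u: "u \<in> A" and lt: "sup_norm u < 1"
  obtains v where "v \<in> A" "\<And>x. (1 - u x) * v x = 1"
proof
  define v where "v = (\<lambda>x. \<Sum>i. u x ^ i)"
  have "uniform_limit UNIV (\<lambda>k x. \<Sum>i<k. u x ^ i) v sequentially"
    unfolding v_def
  proof (rule Weierstrass_m_test)
    show "norm (u x ^ i) \<le> sup_norm u ^ i" for i x
      by (simp add: norm_power power_mono cmod_le_sup_norm u)
    show "summable (\<lambda>i. sup_norm u ^ i)"
      using lt sup_norm_nonneg[OF u] by (intro summable_geometric) auto
  qed
  moreover have "(\<lambda>x. \<Sum>i<k. u x ^ i) \<in> A" for k
  proof -
    have "(\<lambda>x. \<Sum>i<k. u x ^ i) = (\<Sum>i<k. (\<lambda>x. u x ^ i))"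
      by (simp add: fun_eq_iff sum_fun_apply)
    then show ?thesis using sum_mem[of "{..<k}"] power_mem[OF u] by simp
  qed
  ultimately show "v \<in> A" by (rule uniformly_closed[rotated])
  show "(1 - u x) * v x = 1" for x
  proof -
    have *: "cmod (u x) < 1"
      using cmod_le_sup_norm[OF u, of x] lt by simp
    then have "u x \<noteq> 1" by auto
    with * show ?thesis by (simp add: v_def suminf_geometric)
  qed
qed

section \<open>Characters of \<open>A\<close>\<close>

lemma spectrum_one: assumes "\<phi> \<in> spectrum A" shows "\<phi> (\<lambda>_. 1) = 1"
proof -
  obtain f where f: "f \<in> A" "\<phi> f \<noteq> 0"
    using assms by (auto simp: spectrum_def)
  then have "\<phi> ((\<lambda>_. 1) * f) = \<phi> (\<lambda>_. 1) * \<phi> f"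
    using assms const_mem[of 1] unfolding spectrum_def by blast
  moreover have "(\<lambda>_. 1) * f = f" by (simp add: fun_eq_iff)
  ultimately show ?thesis using f by simp
qed

text \<open>If \<open>\<phi> f\<close> exceeded the norm of \<open>f\<close> in modulus, then
  \<open>u = f / \<phi> f\<close> would have norm below one and \<open>\<phi> u = 1\<close>.
  Applying \<open>\<phi>\<close> to \<open>v = 1 + u * v\<close>, where \<open>v\<close> inverts
  \<open>1 - u\<close>, would give \<open>\<phi> v = 1 + \<phi> v\<close>.\<close>

lemma spectrum_contractive:
  assumes \<phi>: "\<phi> \<in> spectrum A" and f: "f \<in> A"
  shows "cmod (\<phi> f) \<le> sup_norm f"
proof (rule ccontr)
  assume "\<not> ?thesis"
  then have lt: "sup_norm f < cmod (\<phi> f)" by simp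
  with sup_norm_nonneg[OF f] have nz: "\<phi> f \<noteq> 0" by auto
  define u where "u = (\<lambda>x. inverse (\<phi> f) * f x)"
  have u: "u \<in> A" unfolding u_def by (rule scale_mem[OF f])
  have "sup_norm u \<le> cmod (inverse (\<phi> f)) * sup_norm f"
    unfolding u_def by (rule sup_norm_scale_le[OF f])
  also have "\<dots> < 1" using lt nz unfolding norm_inverse by (simp add: field_simps)
  finally obtain v where v: "v \<in> A" "\<And>x. (1 - u x) * v x = 1"
    using one_minus_invertible[OF u] by blast
  have hom: "\<phi> (p + q) = \<phi> p + \<phi> q" "\<phi> (p * q) = \<phi> p * \<phi> q"
    "\<phi> ((\<lambda>_. c) * p) = c * \<phi> p" if "p \<in> A" "q \<in> A" for p q c
    using \<phi> that by (auto simp: spectrum_def)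
  have "u = (\<lambda>_. inverse (\<phi> f)) * f" by (simp add: u_def fun_eq_iff)
  then have "\<phi> u = 1" using hom(3)[OF f f] nz by simp
  moreover have "\<phi> v = \<phi> (\<lambda>_. 1) + \<phi> (u * v)"
  proof -
    have "v = (\<lambda>_. 1) + u * v"
      using v(2) by (simp add: fun_eq_iff algebra_simps)
    then show ?thesis using hom(1)[OF const_mem[of 1] mult_mem[OF u v(1)]] by (metis (no_types))
  qed
  ultimately show False using hom(2)[OF u v(1)] spectrum_one[OF \<phi>] by simp
qed

text \<open>Links the underlying space to the spectrum; \<open>restrict\<close> is there because
  characters are represented by extensional functions.\<close>

lemma evaluation_in_spectrum: "restrict (\<lambda>f. f x) A \<in> spectrum A"
  unfolding spectrum_def using const_mem add_mem mult_mem
  by (auto intro!: bexI[of _ "\<lambda>_. 1"])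

section \<open>Closed boundaries and topological zero divisors\<close>

lemma closedin_gelfand_ge:
  assumes g: "g \<in> A"
  shows "closedin (gelfand_topology A) {\<phi> \<in> spectrum A. \<eta> \<le> cmod (\<phi> g)}"
proof -
  have "continuous_map (gelfand_topology A) euclidean (\<lambda>\<phi>. \<phi> g)"
    unfolding gelfand_topology_def
    by (intro continuous_map_from_subtopology continuous_map_product_projection g)
  then have "closedin (gelfand_topology A)
      {\<phi> \<in> topspace (gelfand_topology A). \<phi> g \<in> {z. \<eta> \<le> cmod z}}"
    by (rule closedin_continuous_map_preimage)
      (auto intro!: closed_Collect_le continuous_intros)
  moreover have "topspace (gelfand_topology A) = spectrum A"
    by (auto simp: gelfand_topology_def spectrum_def PiE_def)
  ultimately show ?thesis by simp
qed

text \<open>The lower bound applied to \<open>f ^ k\<close> yields a point where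
  \<open>|f| ^ k * |g|\<close> exceeds \<open>\<eta> / 2\<close> times the \<open>k\<close>-th power
  of the norm of \<open>f\<close>. Such points lie in \<open>K\<close>, the set where
  \<open>|g| \<ge> \<eta> / 2\<close>. If \<open>|f|\<close> stayed strictly below its norm on
  \<open>K\<close>, letting \<open>k\<close> grow would be contradictory; so \<open>f\<close>
  attains its norm on \<open>K\<close>.\<close>

lemma closed_boundary_if_bounded_below:
  assumes g: "g \<in> A" and \<eta>: "\<eta> > 0"
    and below: "\<And>h. h \<in> A \<Longrightarrow> \<eta> * sup_norm h \<le> sup_norm (h * g)"
  shows "closed_boundary A {\<phi> \<in> spectrum A. \<eta> / 2 \<le> cmod (\<phi> g)}"
  unfolding closed_boundary_def
proof (intro conjI closedin_gelfand_ge g ballI)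
  fix f assume f: "f \<in> A"
  define K where "K = {x. \<eta> / 2 \<le> cmod (g x)}"
  \<comment> \<open>Halving \<open>\<eta>\<close> provides the strict inequality: failure at every
    \<open>z\<close> would bound the norm of \<open>h * g\<close> by \<open>\<eta> / 2 * c\<close>,
    below the guaranteed \<open>\<eta> * c\<close>.\<close>
  have hit: "\<exists>z. \<eta> / 2 * c < cmod (h z) * cmod (g z)" if "h \<in> A" "0 < c" "c \<le> sup_norm h" for h c
  proof (rule ccontr)
    assume "\<not> ?thesis"
    then have "sup_norm (h * g) \<le> \<eta> / 2 * c"
      by (intro sup_norm_le) (simp add: norm_mult not_less)
    moreover have "\<eta> * c \<le> \<eta> * sup_norm h" using that \<eta> by simp
    moreover have "\<eta> * c > 0" using that \<eta> by simp
    ultimately show False using below[OF that(1)] by linarith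
  qed
  \<comment> \<open>Testing with the constant 1 shows that \<open>K\<close> is nonempty, so that
    \<open>|f|\<close> has a maximum on it.\<close>
  have "sup_norm (\<lambda>_::'a. 1) \<ge> 1" using cmod_le_sup_norm[OF const_mem[of 1]] by simp
  then obtain z where "\<eta> / 2 < cmod (g z)"
    using hit[OF const_mem[of 1], of 1] by auto
  then have "K \<noteq> {}" by (auto simp: K_def intro: less_imp_le)
  moreover have "compact K"
  proof -
    have "closed K" unfolding K_def
      by (intro closed_Collect_le continuous_intros continuous g)
    then show ?thesis using compact_Int_closed[OF compact_UNIV] by simp
  qed
  moreover have "continuous_on K (\<lambda>x. cmod (f x))"
    by (intro continuous_on_norm continuous_on_subset[OF continuous[OF f]]) auto
  ultimately obtain x where x: "x \<in> K" "\<And>y. y \<in> K \<Longrightarrow> cmod (f y) \<le> cmod (f x)"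
    by (metis continuous_attains_sup)
  have max: "sup_norm f \<le> cmod (f x)"
  proof (rule ccontr)
    assume less: "\<not> ?thesis"
    define M where "M = sup_norm f"
    have lt: "cmod (f x) < M" using less by (simp add: M_def)
    then have M: "M > 0" using norm_ge_zero le_less_trans by blast
    have bound: "\<eta> / 2 < (cmod (f x) / M) ^ k * sup_norm g" for k
    proof -
      have "M ^ k \<le> sup_norm (\<lambda>x. f x ^ k)"
      proof -
        obtain y where y: "\<And>x. cmod (f x) \<le> cmod (f y)"
          using continuous_attains_sup[OF compact_UNIV, of "\<lambda>x. cmod (f x)"] continuous[OF f]
          by (auto intro: continuous_intros)
        then have "M \<le> cmod (f y)" unfolding M_def by (rule sup_norm_le)
        then have "M ^ k \<le> cmod (f y ^ k)" using M by (simp add: norm_power power_mono)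
        also have "\<dots> \<le> sup_norm (\<lambda>x. f x ^ k)" by (rule cmod_le_sup_norm[OF power_mem[OF f]])
        finally show ?thesis .
      qed
      \<comment> \<open>The inequality for \<open>z\<close> is used twice: with
        \<open>|f z| \<le> M\<close> it places \<open>z\<close> in \<open>K\<close>, and then
        maximality of \<open>|f x|\<close> on \<open>K\<close> allows \<open>f z\<close> to be
        replaced by \<open>f x\<close>.\<close>
      then obtain z where z: "\<eta> / 2 * M ^ k < cmod (f z) ^ k * cmod (g z)"
        using hit[OF power_mem[OF f], of "M ^ k" k] M by (auto simp: norm_power)
      also have "\<dots> \<le> M ^ k * cmod (g z)"
        using cmod_le_sup_norm[OF f, of z] by (intro mult_right_mono power_mono) (auto simp: M_def)
      finally have "\<eta> / 2 < cmod (g z)" using M by (simp add: mult.commute)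
      then have "z \<in> K" by (simp add: K_def)
      note z
      also have "cmod (f z) ^ k * cmod (g z) \<le> cmod (f x) ^ k * sup_norm g"
        using x(2)[OF \<open>z \<in> K\<close>] cmod_le_sup_norm[OF g, of z]
        by (intro mult_mono power_mono) auto
      finally show ?thesis using M by (simp add: power_divide field_simps)
    qed
    have "(\<lambda>k. (cmod (f x) / M) ^ k * sup_norm g) \<longlonglongrightarrow> 0 * sup_norm g"
      using lt M by (intro tendsto_mult LIMSEQ_power_zero tendsto_const) auto
    then have "\<eta> / 2 \<le> 0 * sup_norm g"
      by (rule LIMSEQ_le_const) (use bound less_imp_le in blast)
    with \<eta> show False by simp
  qed
  show "\<exists>\<phi>\<in>{\<phi> \<in> spectrum A. \<eta> / 2 \<le> cmod (\<phi> g)}.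
      \<forall>\<psi>\<in>spectrum A. cmod (gelfand f \<psi>) \<le> cmod (gelfand f \<phi>)"
  proof (intro bexI ballI)
    fix \<psi> assume "\<psi> \<in> spectrum A"
    \<comment> \<open>By contractivity no character exceeds the norm of \<open>f\<close>, and
      evaluation at \<open>x\<close> reaches it.\<close>
    then show "cmod (gelfand f \<psi>) \<le> cmod (gelfand f (restrict (\<lambda>f. f x) A))"
      using spectrum_contractive[of \<psi> f] max f by (simp add: gelfand_def)
  qed (use x(1) g evaluation_in_spectrum in \<open>auto simp: K_def\<close>)
qed

text \<open>A point of the Shilov boundary lies in every closed boundary, but a zero of
  \<open>g\<close> is outside the set where \<open>|g| \<ge> \<eta> / 2\<close>. That set is
  therefore no closed boundary, so multiplication by \<open>g\<close> is not bounded below by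
  \<open>\<eta>\<close>.\<close>

lemma zero_on_shilov_boundary_imp_topological_zero_divisor:
  assumes g: "g \<in> A" and Z: "zero_set A g \<inter> shilov_boundary A \<noteq> {}" and \<eta>: "\<eta> > 0"
  obtains h where "h \<in> A" "sup_norm (h * g) < \<eta> * sup_norm h"
proof -
  obtain \<phi> where "\<phi> g = 0" and \<phi>: "\<phi> \<in> shilov_boundary A"
    using Z by (auto simp: zero_set_def gelfand_def)
  then have "\<phi> \<notin> {\<phi> \<in> spectrum A. \<eta> / 2 \<le> cmod (\<phi> g)}" using \<eta> by simp
  with \<phi> have "\<not> closed_boundary A {\<phi> \<in> spectrum A. \<eta> / 2 \<le> cmod (\<phi> g)}"
    unfolding shilov_boundary_def by blast
  then obtain h where "h \<in> A" "\<not> \<eta> * sup_norm h \<le> sup_norm (h * g)"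
    using closed_boundary_if_bounded_below[OF g \<eta>] by blast
  then show thesis by (intro that) auto
qed

section \<open>Invertible tuples and their stability under perturbation\<close>

lemma invertible_tuples_iff:
  "f \<in> invertible_tuples A n \<longleftrightarrow>
     (\<forall>j\<in>{1..n}. f j \<in> A) \<and>
     (\<exists>h. (\<forall>j\<in>{1..n}. h j \<in> A) \<and> (\<forall>x. (\<Sum>j=1..n. h j x * f j x) = 1))"
  (is "?L \<longleftrightarrow> ?R")
proof
  assume L: ?L
  then have "(\<lambda>_. 1) \<in> {\<Sum>j=1..n. h j * f j |h. \<forall>j\<in>{1..n}. h j \<in> A}"
    using const_mem[of 1] by (simp add: invertible_tuples_def)
  then obtain h where h: "\<forall>j\<in>{1..n}. h j \<in> A" "(\<lambda>_. 1) = (\<Sum>j=1..n. h j * f j)" by auto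
  have "(\<Sum>j=1..n. h j x * f j x) = 1" for x
    using fun_cong[OF h(2), of x] by (simp add: sum_fun_apply)
  with h(1) L show ?R by (auto simp: invertible_tuples_def)
next
  assume ?R
  then obtain h where f: "\<And>j. j \<in> {1..n} \<Longrightarrow> f j \<in> A" and h: "\<And>j. j \<in> {1..n} \<Longrightarrow> h j \<in> A"
    and one: "\<And>x. (\<Sum>j=1..n. h j x * f j x) = 1" by blast
  have "\<exists>k. p = (\<Sum>j=1..n. k j * f j) \<and> (\<forall>j\<in>{1..n}. k j \<in> A)" if "p \<in> A" for p
  proof (intro exI conjI ballI)
    \<comment> \<open>Multiplying the Bezout identity by \<open>p\<close> expresses \<open>p\<close>
      through the tuple, so an ideal containing 1 is all of \<open>A\<close>.\<close>
    show "p = (\<Sum>j=1..n. (p * h j) * f j)"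
      using one by (simp add: fun_eq_iff sum_fun_apply mult.assoc flip: sum_distrib_left)
  qed (use that h mult_mem in blast)
  then show ?L
    using f by (auto simp: invertible_tuples_def intro!: sum_mem mult_mem)
qed

text \<open>With Bezout coefficients \<open>h\<close> of \<open>f\<close>, the perturbed sum of
  \<open>h j * (f j + p j)\<close> is \<open>1 - u\<close> with \<open>u\<close> of norm below one.
  Multiplying by its inverse \<open>v\<close> gives the new coefficients
  \<open>v * h j\<close>.\<close>

lemma invertible_tuples_open:
  assumes f: "f \<in> invertible_tuples A n"
  obtains \<delta> where "\<delta> > 0"
    "\<And>p. (\<And>j. j \<in> {1..n} \<Longrightarrow> p j \<in> A \<and> sup_norm (p j) < \<delta>) \<Longrightarrow>
      (\<lambda>j. f j + p j) \<in> invertible_tuples A n"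
proof -
  obtain h where fA: "\<And>j. j \<in> {1..n} \<Longrightarrow> f j \<in> A" and h: "\<And>j. j \<in> {1..n} \<Longrightarrow> h j \<in> A"
    and one: "\<And>x. (\<Sum>j=1..n. h j x * f j x) = 1"
    using f unfolding invertible_tuples_iff by blast
  define S where "S = (\<Sum>j=1..n. sup_norm (h j))"
  have S: "S \<ge> 0" unfolding S_def by (intro sum_nonneg sup_norm_nonneg h)
  show thesis
  proof
    \<comment> \<open>The summand 1 keeps the denominator positive and makes the bound
      \<open>S / (S + 1)\<close> for \<open>u\<close> strictly less than one.\<close>
    show "1 / (S + 1) > 0" using S by simp
    fix p assume p: "\<And>j. j \<in> {1..n} \<Longrightarrow> p j \<in> A \<and> sup_norm (p j) < 1 / (S + 1)"
    define u where "u = - (\<Sum>j=1..n. h j * p j)"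
    have ux: "u x = - (\<Sum>j=1..n. h j x * p j x)" for x
      by (simp add: u_def sum_fun_apply)
    have u: "u \<in> A" unfolding u_def using p h by (intro uminus_mem sum_mem mult_mem) auto
    have "sup_norm u \<le> S * (1 / (S + 1))"
    proof (rule sup_norm_le)
      fix x
      have "cmod (u x) \<le> (\<Sum>j=1..n. cmod (h j x * p j x))"
        unfolding ux norm_minus_cancel by (rule norm_sum)
      also have "\<dots> \<le> (\<Sum>j=1..n. sup_norm (h j) * (1 / (S + 1)))"
      proof (rule sum_mono)
        fix j assume j: "j \<in> {1..n}"
        have "cmod (p j x) \<le> 1 / (S + 1)"
          using p[OF j] cmod_le_sup_norm[of "p j" x] by auto
        then show "cmod (h j x * p j x) \<le> sup_norm (h j) * (1 / (S + 1))"
          unfolding norm_mult using cmod_le_sup_norm[OF h[OF j]] sup_norm_nonneg[OF h[OF j]]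
          by (intro mult_mono) auto
      qed
      finally show "cmod (u x) \<le> S * (1 / (S + 1))" by (simp only: S_def sum_distrib_right)
    qed
    also have "\<dots> < 1" using S by (simp add: field_simps)
    finally obtain v where v: "v \<in> A" "\<And>x. (1 - u x) * v x = 1"
      using one_minus_invertible[OF u] by blast
    show "(\<lambda>j. f j + p j) \<in> invertible_tuples A n"
      unfolding invertible_tuples_iff
    proof (intro conjI ballI exI allI)
      fix x
      have "(\<Sum>j=1..n. (v * h j) x * (f j + p j) x)
          = v x * ((\<Sum>j=1..n. h j x * f j x) + (\<Sum>j=1..n. h j x * p j x))"
        by (simp add: sum_distrib_left algebra_simps flip: sum.distrib)
      also have "\<dots> = (1 - u x) * v x" unfolding one ux by simp
      finally show "(\<Sum>j=1..n. (v * h j) x * (f j + p j) x) = 1" using v(2) by simp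
    qed (use fA p h v(1) in \<open>blast intro: add_mem mult_mem\<close>)+
  qed
qed

section \<open>Adjusting a norm to one\<close>

text \<open>The norm of \<open>a + t h\<close> is Lipschitz in \<open>t\<close>, is below one at
  \<open>t = 0\<close>, and at \<open>t = 2 / sup_norm h\<close> is at least
  \<open>2 - sup_norm a > 1\<close>. The bound on \<open>t * sup_norm h\<close> later keeps
  \<open>t h g\<close> small.\<close>

lemma exists_norm_one_shift:
  assumes a: "a \<in> A" "sup_norm a < 1" and h: "h \<in> A" "sup_norm h > 0"
  obtains t :: real where "0 \<le> t" "t * sup_norm h \<le> 2"
    "sup_norm (a + (\<lambda>x. of_real t * h x)) = 1"
proof -
  define N where "N t = sup_norm (a + (\<lambda>x. complex_of_real t * h x))" for t
  have mem: "a + (\<lambda>x. complex_of_real t * h x) \<in> A" for t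
    by (intro add_mem a scale_mem h)
  have lip: "N t \<le> N s + \<bar>t - s\<bar> * sup_norm h" for s t
  proof -
    have "a + (\<lambda>x. complex_of_real t * h x)
        = (a + (\<lambda>x. complex_of_real s * h x)) + (\<lambda>x. complex_of_real (t - s) * h x)"
      by (simp add: fun_eq_iff algebra_simps)
    then have "N t \<le> N s + sup_norm (\<lambda>x. complex_of_real (t - s) * h x)"
      unfolding N_def using sup_norm_add_le[OF mem scale_mem[OF h(1)]] by (simp only:)
    also have "sup_norm (\<lambda>x. complex_of_real (t - s) * h x) \<le> \<bar>t - s\<bar> * sup_norm h"
      using sup_norm_scale_le[OF h(1), of "complex_of_real (t - s)"] unfolding norm_of_real .
    finally show ?thesis by simp
  qed
  have "(sup_norm h)-lipschitz_on UNIV N"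
  proof (rule lipschitz_onI)
    show "dist (N t) (N s) \<le> sup_norm h * dist t s" for t s
      using lip[of t s] lip[of s t] by (simp add: dist_real_def abs_minus_commute mult.commute)
  qed (use h in simp)
  then have cont: "continuous_on {0..2 / sup_norm h} N"
    using lipschitz_on_continuous_on continuous_on_subset by blast
  have "N 0 = sup_norm a" by (simp add: N_def plus_fun_def)
  moreover have "N (2 / sup_norm h) \<ge> 1"
  proof -
    define T where "T = 2 / sup_norm h"
    have T: "T > 0" using h by (simp add: T_def)
    \<comment> \<open>The triangle inequality, divided by \<open>T\<close>, bounds
      \<open>|h|\<close> pointwise and hence its supremum.\<close>
    have "sup_norm h \<le> (N T + sup_norm a) / T"
    proof (rule sup_norm_le)
      fix x
      have "T * cmod (h x) = cmod ((a x + of_real T * h x) - a x)"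
        using T by (simp add: norm_mult)
      also have "\<dots> \<le> cmod (a x + of_real T * h x) + cmod (a x)" by (rule norm_triangle_ineq4)
      also have "\<dots> \<le> N T + sup_norm a"
        using cmod_le_sup_norm[OF mem[of T], of x] cmod_le_sup_norm[OF a(1), of x]
        by (simp add: N_def)
      finally show "cmod (h x) \<le> (N T + sup_norm a) / T" using T by (simp add: field_simps)
    qed
    then have "T * sup_norm h \<le> N T + sup_norm a" using T by (simp add: field_simps)
    moreover have "T * sup_norm h = 2" using h by (simp add: T_def)
    ultimately show ?thesis using a(2) unfolding T_def by linarith
  qed
  ultimately obtain t where "0 \<le> t" "t \<le> 2 / sup_norm h" "N t = 1"
    using IVT'[of N 0 1 "2 / sup_norm h"] a(2) h cont by auto
  then show thesis using h by (intro that) (auto simp: N_def field_simps)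
qed

end

section \<open>Attainment of the rank and norm-one reducibility\<close>

lemma snr_eq_enatD:
  assumes "snr nrm A = enat n" shows "small_norm_reducible nrm A n"
proof -
  let ?S = "{enat n |n. 1 \<le> n \<and> small_norm_reducible nrm A n}"
  \<comment> \<open>The empty set would have infimum \<open>\<infinity>\<close>; a nonempty set of
    extended naturals contains its infimum.\<close>
  have "?S \<noteq> {}" using assms unfolding snr_def by (auto simp: Inf_enat_def split: if_splits)
  then have "Inf ?S \<in> ?S"
    unfolding Inf_enat_def by (metis (no_types, lifting) LeastI ex_in_conv)
  then show ?thesis using assms unfolding snr_def by auto
qed

theorem proposition3p2:
  fixes A :: "('a::t2_space \<Rightarrow> complex) set"
    and f :: "nat \<Rightarrow> 'a \<Rightarrow> complex" and g :: "'a \<Rightarrow> complex" and n :: nat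
  assumes "uniform_algebra A"
    and "snr sup_norm A = enat n"
    and "f(Suc n := g) \<in> invertible_tuples A (Suc n)"
    and "zero_set A g \<inter> shilov_boundary A \<noteq> {}"
  shows "\<exists>c. (\<forall>j\<in>{1..n}. c j \<in> A \<and> sup_norm (c j) = 1) \<and>
             (\<lambda>j. f j + c j * g) \<in> invertible_tuples A n"
proof -
  interpret uniform_algebra A by fact
  have g: "g \<in> A" using assms(3) unfolding invertible_tuples_iff by (auto dest: bspec[of _ _ "Suc n"])
  \<comment> \<open>Small-norm reducibility is applied with \<open>\<epsilon> = 1\<close>.\<close>
  obtain a where a: "\<And>j. j \<in> {1..n} \<Longrightarrow> a j \<in> A \<and> sup_norm (a j) < 1"
    and inv: "(\<lambda>j. f j + a j * g) \<in> invertible_tuples A n"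
    using snr_eq_enatD[OF assms(2)] assms(3) unfolding small_norm_reducible_def
    by (meson zero_less_one)
  obtain \<delta> where \<delta>: "\<delta> > 0"
    and pert: "\<And>p. (\<And>j. j \<in> {1..n} \<Longrightarrow> p j \<in> A \<and> sup_norm (p j) < \<delta>) \<Longrightarrow>
      (\<lambda>j. (f j + a j * g) + p j) \<in> invertible_tuples A n"
    using invertible_tuples_open[OF inv] by blast
  \<comment> \<open>The factor \<open>\<delta> / 3\<close> fits the bound
    \<open>t * sup_norm h \<le> 2\<close>: the norm of \<open>t h g\<close> is then at most
    \<open>2 \<delta> / 3 < \<delta>\<close>.\<close>
  obtain h where h: "h \<in> A" and small: "sup_norm (h * g) < \<delta> / 3 * sup_norm h"
    using zero_on_shilov_boundary_imp_topological_zero_divisor[OF g assms(4), of "\<delta> / 3"] \<delta> by auto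
  have hg: "h * g \<in> A" by (rule mult_mem[OF h g])
  \<comment> \<open>The strict inequality forces \<open>h\<close> to be nonzero, as the norm
    adjustment requires.\<close>
  have "0 < \<delta> / 3 * sup_norm h" using small sup_norm_nonneg[OF hg] by linarith
  then have hpos: "sup_norm h > 0" using \<delta> by (simp add: zero_less_mult_iff)
  \<comment> \<open>A single \<open>h\<close> serves all indices; only the factor \<open>t\<close>
    depends on \<open>j\<close>.\<close>
  have "\<exists>t::real. 0 \<le> t \<and> t * sup_norm h \<le> 2 \<and>
      sup_norm (a j + (\<lambda>x. of_real t * h x)) = 1" if "j \<in> {1..n}" for j
    using exists_norm_one_shift[of "a j" h] a[OF that] h hpos by blast
  then obtain t :: "nat \<Rightarrow> real" where t: "\<And>j. j \<in> {1..n} \<Longrightarrow> 0 \<le> t j \<and> t j * sup_norm h \<le> 2 \<and>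
      sup_norm (a j + (\<lambda>x. of_real (t j) * h x)) = 1"
    by metis
  \<comment> \<open>This is the change in the \<open>j\<close>-th entry of \<open>f + a g\<close>
    when \<open>a j\<close> is replaced by \<open>a j + t j * h\<close>.\<close>
  define p where "p j = (\<lambda>x. complex_of_real (t j) * (h * g) x)" for j
  have "p j \<in> A \<and> sup_norm (p j) < \<delta>" if j: "j \<in> {1..n}" for j
  proof
    show "p j \<in> A" unfolding p_def by (rule scale_mem[OF hg])
    have "sup_norm (p j) \<le> t j * sup_norm (h * g)"
      unfolding p_def using sup_norm_scale_le[OF hg, of "complex_of_real (t j)"] t[OF j] by simp
    also have "\<dots> \<le> t j * (\<delta> / 3 * sup_norm h)"
      using small t[OF j] by (intro mult_left_mono) auto
    also have "\<dots> = \<delta> / 3 * (t j * sup_norm h)" by simp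
    also have "\<dots> \<le> \<delta> / 3 * 2" using t[OF j] \<delta> by (intro mult_left_mono) auto
    also have "\<dots> < \<delta>" using \<delta> by simp
    finally show "sup_norm (p j) < \<delta>" .
  qed
  then have "(\<lambda>j. (f j + a j * g) + p j) \<in> invertible_tuples A n" by (rule pert)
  moreover have "(\<lambda>j. (f j + a j * g) + p j)
      = (\<lambda>j. f j + (a j + (\<lambda>x. of_real (t j) * h x)) * g)"
    by (simp add: fun_eq_iff p_def algebra_simps)
  ultimately show ?thesis
    using t a by (intro exI[of _ "\<lambda>j. a j + (\<lambda>x. of_real (t j) * h x)"])
      (auto intro!: add_mem scale_mem h)
qed

end
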